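(* $[\mathcal{R}\mathbf{Txt}\mathbf{Td}\mathbf{CInd}\mathbf{Ex}_C]_{\mathbf{REC}} \subsetneq [\mathbf{Txt}\mathbf{Td}\mathbf{CInd}\mathbf{Ex}_C]_{\mathbf{REC}}$.
   Context: Fix an acceptable numbering $(\varphi_e)_{e\in\mathbb{N}}$ of all partial computable functions. A number $e$ is a $C$-index if $\varphi_e$ is total with values in $\{0,1\}$; then $C_e=\{x:\varphi_e(x)=1\}$. $\mathbf{REC}$ is the collection of recursive subsets of $\mathbb{N}$; $\mathcal{P}$ and $\mathcal{R}$ are the partial computable and total computable functions. Fix a pause symbol $\#$. A text is a total function $T:\mathbb{N}\to\mathbb{N}\cup\{\#\}$, $\mathrm{content}(T)=\mathrm{range}(T)\setminus\{\#\}$, $T$ is a text for $L$ if $\mathrm{content}(T)=L$. A learner is some $h\in\mathcal{P}$, which may output a special symbol "?" meaning "no new hypothesis". Transductive hypothesis sequence: $\mathbf{Td}(h,T)(0)=?$, and for $i>0$, $\mathbf{Td}(h,T)(i)=\mathbf{Td}(h,T)(i-1)$ if $h(T(i-1))=?$, else $h(T(i-1))$. Restrictions on a hypothesis sequence $p$ and text $T$: $\mathbf{Ex}_C$: there is $n_0$ with $p(n)=p(n_0)$ for all $n\ge n_0$ and $p(n_0)$ a $C$-index with $C_{p(n_0)}=\mathrm{content}(T)$; $\mathbf{CInd}$: for all $i$, $p(i)$ is a $C$-index. Juxtaposition means conjunction. For $\mathcal{C}\in\{\mathcal{P},\mathcal{R}\}$ (omitted means $\mathcal{P}$), $h\in\mathcal{C}$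 $\mathcal{C}\mathbf{Txt}\beta\delta$-learns $L$ iff $\delta(\beta(h,T),T)$ holds for every text $T$ for $L$; $[\mathcal{C}\mathbf{Txt}\beta\delta]_{\mathbf{REC}}$ is the set of all classes $\mathcal{L}\subseteq\mathbf{REC}$ for which some $h\in\mathcal{C}$ learns every $L\in\mathcal{L}$. *)

theory Defs
  imports Main
begin

section \<open>Partial computable functions\<close>

text \<open>
  An \<open>n\<close>-ary partial function is represented by its values on lists of length \<open>n\<close>; its values on
  lists of other lengths are irrelevant. Undefinedness is \<^term>\<open>None\<close>.
\<close>

definition comp_fun :: "(nat list \<rightharpoonup> nat) \<Rightarrow> (nat list \<rightharpoonup> nat) list \<Rightarrow> (nat list \<rightharpoonup> nat)" where
  "comp_fun f gs xs = Option.bind (those (map (\<lambda>g. g xs) gs)) f"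

fun prim_rec :: "(nat list \<rightharpoonup> nat) \<Rightarrow> (nat list \<rightharpoonup> nat) \<Rightarrow> nat \<Rightarrow> (nat list \<rightharpoonup> nat)" where
  "prim_rec f g 0 xs = f xs"
| "prim_rec f g (Suc k) xs = Option.bind (prim_rec f g k xs) (\<lambda>y. g (k # y # xs))"

text \<open>Unbounded search is defined only if all values before the first zero are defined.\<close>

definition mu_fun :: "(nat list \<rightharpoonup> nat) \<Rightarrow> (nat list \<rightharpoonup> nat)" where
  "mu_fun f xs =
     (if \<exists>k. f (k # xs) = Some 0 \<and> (\<forall>j<k. \<exists>y>0. f (j # xs) = Some y)
      then Some (LEAST k. f (k # xs) = Some 0) else None)"

inductive partial_recursive :: "nat \<Rightarrow> (nat list \<rightharpoonup> nat) \<Rightarrow> bool" where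
  zero: "partial_recursive n (\<lambda>xs. Some 0)"
| succ: "partial_recursive 1 (\<lambda>xs. Some (Suc (hd xs)))"
| proj: "i < n \<Longrightarrow> partial_recursive n (\<lambda>xs. Some (xs ! i))"
| comp: "partial_recursive (length gs) f \<Longrightarrow> (\<forall>g\<in>set gs. partial_recursive n g) \<Longrightarrow>
         partial_recursive n (comp_fun f gs)"
| prec: "partial_recursive n f \<Longrightarrow> partial_recursive (n + 2) g \<Longrightarrow>
         partial_recursive (n + 1) (\<lambda>xs. prim_rec f g (hd xs) (tl xs))"
| mu:   "partial_recursive (n + 1) f \<Longrightarrow> partial_recursive n (mu_fun f)"

definition partial_computable :: "(nat \<rightharpoonup> nat) \<Rightarrow> bool" where
  "partial_computable f \<longleftrightarrow> (\<exists>g. partial_recursive 1 g \<and> (\<forall>x. f x = g [x]))"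

definition partial_computable2 :: "(nat \<Rightarrow> nat \<rightharpoonup> nat) \<Rightarrow> bool" where
  "partial_computable2 f \<longleftrightarrow> (\<exists>g. partial_recursive 2 g \<and> (\<forall>x y. f x y = g [x, y]))"

definition total_computable :: "(nat \<Rightarrow> nat) \<Rightarrow> bool" where
  "total_computable f \<longleftrightarrow> partial_computable (\<lambda>x. Some (f x))"

text \<open>
  Acceptable numberings in the sense of Rogers: the universal function is partial computable, and
  every computable numbering of partial computable functions translates computably into \<open>\<phi>\<close>.
\<close>

definition acceptable_numbering :: "(nat \<Rightarrow> nat \<rightharpoonup> nat) \<Rightarrow> bool" where
  "acceptable_numbering \<phi> \<longleftrightarrow>
     range \<phi> = {f. partial_computable f} \<and>
     partial_computable2 \<phi> \<and>
     (\<forall>\<psi>. partial_computable2 \<psi> \<longrightarrow>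
        (\<exists>s. total_computable s \<and> (\<forall>i x. \<phi> (s i) x = \<psi> i x)))"

definition C_index :: "(nat \<Rightarrow> nat \<rightharpoonup> nat) \<Rightarrow> nat \<Rightarrow> bool" where
  "C_index \<phi> e \<longleftrightarrow> (\<forall>x. \<phi> e x = Some 0 \<or> \<phi> e x = Some 1)"

definition C_set :: "(nat \<Rightarrow> nat \<rightharpoonup> nat) \<Rightarrow> nat \<Rightarrow> nat set" where
  "C_set \<phi> e = {x. \<phi> e x = Some 1}"

definition REC :: "nat set set" where
  "REC = {A. total_computable (\<lambda>x. if x \<in> A then 1 else 0)}"


section \<open>Texts and learners\<close>

text \<open>\<open>Pause\<close> is the pause symbol \<open>#\<close>; \<open>NoHyp\<close> is the symbol \<open>?\<close>.\<close>

datatype symbol = Pause | Elem nat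

datatype hypothesis = NoHyp | Hyp nat

type_synonym learner = "symbol \<rightharpoonup> hypothesis"

type_synonym hyp_seq = "nat \<rightharpoonup> hypothesis"

definition content :: "(nat \<Rightarrow> symbol) \<Rightarrow> nat set" where
  "content T = {x. Elem x \<in> range T}"

fun symbol_code :: "symbol \<Rightarrow> nat" where
  "symbol_code Pause = 0"
| "symbol_code (Elem x) = Suc x"

fun hypothesis_code :: "hypothesis \<Rightarrow> nat" where
  "hypothesis_code NoHyp = 0"
| "hypothesis_code (Hyp e) = Suc e"

text \<open>
  Learners operate on \<open>\<nat> \<union> {#}\<close> and \<open>\<nat> \<union> {?}\<close>; both are identified with \<open>\<nat>\<close> by the bijections
  above.
\<close>

definition partial_learners :: "learner set" where
  "partial_learners =
     {h. \<exists>f. partial_computable f \<and>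
         (\<forall>s. map_option hypothesis_code (h s) = f (symbol_code s))}"

definition total_learners :: "learner set" where
  "total_learners = {h \<in> partial_learners. \<forall>s. h s \<noteq> None}"

text \<open>
  A hypothesis sequence takes the value \<^term>\<open>None\<close> where the learner diverges, as opposed to
  \<^term>\<open>Some NoHyp\<close>, where it has not yet output a hypothesis.
\<close>

fun Td :: "learner \<Rightarrow> (nat \<Rightarrow> symbol) \<Rightarrow> hyp_seq" where
  "Td h T 0 = Some NoHyp"
| "Td h T (Suc i) = (if h (T i) = Some NoHyp then Td h T i else h (T i))"

definition ExC :: "(nat \<Rightarrow> nat \<rightharpoonup> nat) \<Rightarrow> hyp_seq \<Rightarrow> (nat \<Rightarrow> symbol) \<Rightarrow> bool" where
  "ExC \<phi> p T \<longleftrightarrow>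
     (\<exists>n0 e. (\<forall>n\<ge>n0. p n = p n0) \<and> p n0 = Some (Hyp e) \<and>
             C_index \<phi> e \<and> C_set \<phi> e = content T)"

text \<open>
  The symbol \<open>?\<close> is not a hypothesis, so it is exempt from having to be a \<open>C\<close>-index (transductive
  sequences always start with it). An undefined value is not exempt.
\<close>

definition CInd :: "(nat \<Rightarrow> nat \<rightharpoonup> nat) \<Rightarrow> hyp_seq \<Rightarrow> (nat \<Rightarrow> symbol) \<Rightarrow> bool" where
  "CInd \<phi> p T \<longleftrightarrow> (\<forall>i. p i = Some NoHyp \<or> (\<exists>e. p i = Some (Hyp e) \<and> C_index \<phi> e))"

text \<open>Interaction operators \<open>\<beta>\<close> and restrictions \<open>\<delta>\<close> are parameters.\<close>

definition Txt_learns ::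
  "(learner \<Rightarrow> (nat \<Rightarrow> symbol) \<Rightarrow> hyp_seq) \<Rightarrow> (hyp_seq \<Rightarrow> (nat \<Rightarrow> symbol) \<Rightarrow> bool) \<Rightarrow>
   learner \<Rightarrow> nat set \<Rightarrow> bool" where
  "Txt_learns \<beta> \<delta> h L \<longleftrightarrow> (\<forall>T. content T = L \<longrightarrow> \<delta> (\<beta> h T) T)"

definition Txt_REC ::
  "learner set \<Rightarrow> (learner \<Rightarrow> (nat \<Rightarrow> symbol) \<Rightarrow> hyp_seq) \<Rightarrow>
   (hyp_seq \<Rightarrow> (nat \<Rightarrow> symbol) \<Rightarrow> bool) \<Rightarrow> nat set set set" where
  "Txt_REC \<C> \<beta> \<delta> = {\<L>. \<L> \<subseteq> REC \<and> (\<exists>h\<in>\<C>. \<forall>L\<in>\<L>. Txt_learns \<beta> \<delta> h L)}"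

end

theory Submission
  imports Defs
begin

text \<open>
  On a language \<open>L\<close> of the class, a transductive learner may output only \<open>?\<close> and one fixed index,
  since a text may repeat every element infinitely often. Hence a total learner \<open>\<phi>\<^sub>i\<close> is defeated by
  looking at its output on \<open>3i\<close>. If this is \<open>?\<close>, the class contains \<open>{3i}\<close>, on which \<open>\<phi>\<^sub>i\<close> never
  outputs a hypothesis. If it is a hypothesis, the class contains both \<open>{3i, 3i + 1}\<close> and
  \<open>{3i, 3i + 2}\<close>, which \<open>\<phi>\<^sub>i\<close> would have to identify with the same index. A partial learner
  simulates \<open>\<phi>\<^sub>i\<close> on \<open>3i\<close>; it outputs \<open>?\<close> exactly in the second case, and it may diverge if the
  simulation does, as then \<open>3i\<close> belongs to no language of the class.
\<close>

section \<open>Closure properties of partial recursive functions\<close>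

text \<open>Only arguments of length \<open>n\<close> matter, whereas
  \<open>partial_recursive\<close> fixes a function on lists of every length. Closing under
  agreement on length \<open>n\<close> admits arbitrary lambda terms.\<close>

definition computable :: "nat \<Rightarrow> (nat list \<rightharpoonup> nat) \<Rightarrow> bool" where
  "computable n f \<longleftrightarrow> (\<exists>g. partial_recursive n g \<and> (\<forall>xs. length xs = n \<longrightarrow> f xs = g xs))"

abbreviation computable_total :: "nat \<Rightarrow> (nat list \<Rightarrow> nat) \<Rightarrow> bool" where
  "computable_total n f \<equiv> computable n (\<lambda>xs. Some (f xs))"

lemma computableI: "partial_recursive n f \<Longrightarrow> computable n f"
  unfolding computable_def by blast

lemma computable_cong:
  assumes "computable n f" "\<And>xs. length xs = n \<Longrightarrow> f xs = f' xs"
  shows "computable n f'"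
  using assms unfolding computable_def by metis

lemma length_those: "those xs = Some ys \<Longrightarrow> length ys = length xs"
  by (induction xs arbitrary: ys) (auto split: option.splits)

lemma computable_comp_fun:
  assumes f: "computable (length gs) f" and gs: "\<And>g. g \<in> set gs \<Longrightarrow> computable n g"
  shows "computable n (comp_fun f gs)"
proof -
  obtain f' where f': "partial_recursive (length gs) f'"
      "\<And>ys. length ys = length gs \<Longrightarrow> f ys = f' ys"
    using f unfolding computable_def by blast
  obtain r where r: "\<And>g. g \<in> set gs \<Longrightarrow> partial_recursive n (r g)"
      "\<And>g xs. g \<in> set gs \<Longrightarrow> length xs = n \<Longrightarrow> g xs = r g xs"
    using gs unfolding computable_def by metis
  have "partial_recursive n (comp_fun f' (map r gs))"
    using f'(1) r(1) by (intro partial_recursive.comp) auto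
  then show ?thesis
  proof (rule computable_cong[OF computableI])
    fix xs :: "nat list"
    assume len: "length xs = n"
    have eq: "map (\<lambda>g. g xs) (map r gs) = map (\<lambda>g. g xs) gs"
      using r(2)[OF _ len] by auto
    \<comment> \<open>\<open>f\<close> and its representative agree only on lists of the right
      length, which \<open>those\<close> preserves.\<close>
    have "f' ys = f ys" if "those (map (\<lambda>g. g xs) gs) = Some ys" for ys
      using length_those[OF that] f'(2) by simp
    then show "comp_fun f' (map r gs) xs = comp_fun f gs xs"
      unfolding comp_fun_def eq by (cases "those (map (\<lambda>g. g xs) gs)") auto
  qed
qed

text \<open>The binds express that composition is strict: it diverges as soon as one argument does.
  For total arguments they simplify away.\<close>

lemma computable_bind1:
  assumes "computable 1 f" "computable n a"
  shows "computable n (\<lambda>xs. Option.bind (a xs) (\<lambda>x. f [x]))"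
  by (rule computable_cong[OF computable_comp_fun[of "[a]" f]])
    (use assms in \<open>auto simp: comp_fun_def split: option.splits\<close>)

lemma computable_bind2:
  assumes "computable 2 f" "computable n a" "computable n b"
  shows "computable n (\<lambda>xs. Option.bind (a xs) (\<lambda>x. Option.bind (b xs) (\<lambda>y. f [x, y])))"
  by (rule computable_cong[OF computable_comp_fun[of "[a, b]" f]])
    (use assms in \<open>auto simp: comp_fun_def numeral_2_eq_2 split: option.splits\<close>)

lemma computable_bind3:
  assumes "computable 3 f" "computable n a" "computable n b" "computable n c"
  shows "computable n (\<lambda>xs. Option.bind (a xs) (\<lambda>x. Option.bind (b xs) (\<lambda>y.
           Option.bind (c xs) (\<lambda>z. f [x, y, z]))))"
  by (rule computable_cong[OF computable_comp_fun[of "[a, b, c]" f]])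
    (use assms in \<open>auto simp: comp_fun_def numeral_3_eq_3 split: option.splits\<close>)

section \<open>Arithmetic and case distinction for total functions\<close>

lemma computable_total_nth: "i < n \<Longrightarrow> computable_total n (\<lambda>xs. xs ! i)"
  by (intro computableI partial_recursive.proj)

lemma computable_total_Suc:
  assumes "computable_total n a"
  shows "computable_total n (\<lambda>xs. Suc (a xs))"
  using computable_bind1[OF computableI[OF partial_recursive.succ] assms] by simp

lemma computable_total_const: "computable_total n (\<lambda>xs. k)"
  by (induction k) (auto intro: computableI partial_recursive.zero computable_total_Suc)

lemma computable_total_rec_nat:
  assumes "computable_total n f" "computable_total (n + 2) g"
  shows "computable_total (n + 1)
           (\<lambda>xs. rec_nat (f (tl xs)) (\<lambda>k y. g (k # y # tl xs)) (hd xs))"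
proof -
  obtain f' where f': "partial_recursive n f'" "\<And>xs. length xs = n \<Longrightarrow> f' xs = Some (f xs)"
    using assms(1) unfolding computable_def by metis
  obtain g' where g': "partial_recursive (n + 2) g'"
      "\<And>xs. length xs = n + 2 \<Longrightarrow> g' xs = Some (g xs)"
    using assms(2) unfolding computable_def by metis
  have "prim_rec f' g' k ys = Some (rec_nat (f ys) (\<lambda>k y. g (k # y # ys)) k)"
    if "length ys = n" for k ys
    using that by (induction k) (auto simp: f' g')
  then show ?thesis
    by (intro computable_cong[OF computableI[OF partial_recursive.prec[OF f'(1) g'(1)]]]) simp
qed

lemma computable_total_rec_nat1:
  assumes "computable_total 2 (\<lambda>xs. g (xs ! 0) (xs ! 1))" "computable_total n a"
  shows "computable_total n (\<lambda>xs. rec_nat c g (a xs))"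
proof -
  have "computable_total (0 + 1)
          (\<lambda>xs. rec_nat c (\<lambda>k y. g ((k # y # tl xs) ! 0) ((k # y # tl xs) ! 1)) (hd xs))"
    using assms(1) by (intro computable_total_rec_nat computable_total_const) (simp add: numeral_2_eq_2)
  from computable_bind1[OF this[unfolded add_0] assms(2)] show ?thesis
    by simp
qed

lemma computable_total_if0:
  assumes "computable_total n a" "computable_total n b" "computable_total n c"
  shows "computable_total n (\<lambda>xs. if a xs = 0 then b xs else c xs)"
proof -
  \<comment> \<open>A recursion that ignores its previous value acts as a case distinction. The
    parameters are the two branch values, so index 3 of \<open>k # y # tl xs\<close> is the second
    branch.\<close>
  have "computable_total (2 + 1)
          (\<lambda>xs. rec_nat (tl xs ! 0) (\<lambda>k y. (k # y # tl xs) ! 3) (hd xs))"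
    by (intro computable_total_rec_nat computable_total_nth) auto
  then have "computable_total 3 (\<lambda>xs. rec_nat (tl xs ! 0) (\<lambda>k y. (k # y # tl xs) ! 3) (hd xs))"
    by simp
  from computable_bind3[OF this assms]
  have *: "computable_total n (\<lambda>xs. rec_nat (b xs) (\<lambda>k y. c xs) (a xs))"
    by simp
  have "rec_nat (b xs) (\<lambda>k y. c xs) (a xs) = (if a xs = 0 then b xs else c xs)" for xs
    by (cases "a xs") auto
  with * show ?thesis by simp
qed

lemma computable_total_pred:
  assumes "computable_total n a"
  shows "computable_total n (\<lambda>xs. a xs - 1)"
proof -
  have "rec_nat 0 (\<lambda>k y. k) m = m - 1" for m :: nat
    by (cases m) auto
  with computable_total_rec_nat1[OF computable_total_nth[of 0 2] assms, of 0] show ?thesis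
    by simp
qed

lemma computable_total_diff:
  assumes "computable_total n a" "computable_total n b"
  shows "computable_total n (\<lambda>xs. a xs - b xs)"
proof -
  \<comment> \<open>Truncated subtraction is iterated predecessor. The recursion runs over the
    subtrahend, so the arguments are swapped below.\<close>
  have "computable_total (1 + 1)
          (\<lambda>xs. rec_nat (tl xs ! 0) (\<lambda>k y. (k # y # tl xs) ! 1 - 1) (hd xs))"
    by (intro computable_total_rec_nat computable_total_pred computable_total_nth) auto
  then have "computable_total 2 (\<lambda>xs. rec_nat (tl xs ! 0) (\<lambda>k y. y - 1) (hd xs))"
    by (simp add: numeral_2_eq_2)
  from computable_bind2[OF this assms(2,1)]
  have *: "computable_total n (\<lambda>xs. rec_nat (a xs) (\<lambda>k y. y - 1) (b xs))"
    by simp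
  have "rec_nat m (\<lambda>k y. y - 1) k = m - k" for m k :: nat
    by (induction k) auto
  with * show ?thesis by simp
qed

lemma computable_total_if_eq:
  assumes "computable_total n a" "computable_total n b"
    and "computable_total n c" "computable_total n d"
  shows "computable_total n (\<lambda>xs. if a xs = b xs then c xs else d xs)"
proof -
  \<comment> \<open>Natural numbers are equal iff both truncated differences vanish.\<close>
  have "computable_total n
          (\<lambda>xs. if a xs - b xs = 0 then if b xs - a xs = 0 then c xs else d xs else d xs)"
    by (intro computable_total_if0 computable_total_diff assms)
  moreover have "(if a xs - b xs = 0 then if b xs - a xs = 0 then c xs else d xs else d xs)
      = (if a xs = b xs then c xs else d xs)" for xs
    by auto
  ultimately show ?thesis by simp
qed

lemma computable_total_mod3:
  assumes "computable_total n a"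
  shows "computable_total n (\<lambda>xs. a xs mod 3)"
proof -
  \<comment> \<open>A cyclic counter through 0, 1, 2.\<close>
  have "computable_total n (\<lambda>xs. rec_nat 0 (\<lambda>k y. if y = 2 then 0 else Suc y) (a xs))"
    by (intro computable_total_rec_nat1 computable_total_if_eq computable_total_Suc
        computable_total_nth computable_total_const assms) auto
  moreover have "rec_nat 0 (\<lambda>k y. if y = 2 then 0 else Suc y) m = m mod 3" for m :: nat
    by (induction m) (auto simp: mod_Suc)
  ultimately show ?thesis by simp
qed

lemma computable_total_div3:
  assumes "computable_total n a"
  shows "computable_total n (\<lambda>xs. a xs div 3)"
proof -
  \<comment> \<open>The quotient grows exactly on passing a \<open>k\<close> of residue 2.\<close>
  have "computable_total n (\<lambda>xs. rec_nat 0 (\<lambda>k y. if k mod 3 = 2 then Suc y else y) (a xs))"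
    by (intro computable_total_rec_nat1 computable_total_if_eq computable_total_mod3
        computable_total_Suc computable_total_nth computable_total_const assms) auto
  moreover have "rec_nat 0 (\<lambda>k y. if k mod 3 = 2 then Suc y else y) m = m div 3" for m :: nat
    by (induction m) (auto simp: div_Suc mod_Suc)
  ultimately show ?thesis by simp
qed

section \<open>From list arguments to unary and binary functions\<close>

lemma computable_1_iff: "computable 1 (\<lambda>xs. f (xs ! 0)) \<longleftrightarrow> partial_computable f"
proof
  assume "computable 1 (\<lambda>xs. f (xs ! 0))"
  then obtain g where "partial_recursive 1 g" "\<forall>xs. length xs = 1 \<longrightarrow> f (xs ! 0) = g xs"
    unfolding computable_def by blast
  then show "partial_computable f"
    unfolding partial_computable_def
    by (metis One_nat_def length_Cons list.size(3) nth_Cons_0)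
next
  assume "partial_computable f"
  then obtain g where "partial_recursive 1 g" "\<forall>x. f x = g [x]"
    unfolding partial_computable_def by blast
  then show "computable 1 (\<lambda>xs. f (xs ! 0))"
    unfolding computable_def by (auto simp: length_Suc_conv)
qed

lemma computable_2_iff: "computable 2 (\<lambda>xs. f (xs ! 0) (xs ! 1)) \<longleftrightarrow> partial_computable2 f"
proof
  assume "computable 2 (\<lambda>xs. f (xs ! 0) (xs ! 1))"
  then obtain g where g: "partial_recursive 2 g"
      "\<And>xs. length xs = 2 \<Longrightarrow> f (xs ! 0) (xs ! 1) = g xs"
    unfolding computable_def by blast
  have "f x y = g [x, y]" for x y
    using g(2)[of "[x, y]"] by simp
  with g(1) show "partial_computable2 f"
    unfolding partial_computable2_def by blast
next
  assume "partial_computable2 f"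
  then obtain g where "partial_recursive 2 g" "\<forall>x y. f x y = g [x, y]"
    unfolding partial_computable2_def by blast
  then show "computable 2 (\<lambda>xs. f (xs ! 0) (xs ! 1))"
    unfolding computable_def by (auto simp: length_Suc_conv numeral_2_eq_2)
qed

section \<open>Transductive learning\<close>

text \<open>Every text for \<open>L\<close> eventually shows \<open>x\<close>. From then on the
  hypothesis stays \<open>e\<close>, because \<open>?\<close> keeps it and any other output repeats
  it; earlier hypotheses are \<open>?\<close> or \<open>e\<close>.\<close>

lemma transductive_learnsI:
  assumes pause: "h Pause = Some NoHyp"
    and elem: "\<And>x. x \<in> L \<Longrightarrow> h (Elem x) \<in> {Some NoHyp, Some (Hyp e)}"
    and x: "x \<in> L" "h (Elem x) = Some (Hyp e)"
    and e: "C_index \<phi> e" "C_set \<phi> e = L"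
  shows "Txt_learns Td (\<lambda>p T. CInd \<phi> p T \<and> ExC \<phi> p T) h L"
  unfolding Txt_learns_def
proof (intro allI impI)
  fix T
  assume T: "content T = L"
  have hT: "h (T i) \<in> {Some NoHyp, Some (Hyp e)}" for i
  proof (cases "T i")
    case (Elem y)
    then have "y \<in> L" using T unfolding content_def by (metis mem_Collect_eq rangeI)
    with Elem elem show ?thesis by simp
  qed (simp add: pause)
  have td: "Td h T i \<in> {Some NoHyp, Some (Hyp e)}" for i
    using hT by (induction i) auto
  obtain k where k: "T k = Elem x"
    using x(1) T unfolding content_def by force
  \<comment> \<open>\<open>Suc k\<close> is the first position that takes \<open>T k\<close> into
    account.\<close>
  have conv: "Td h T n = Some (Hyp e)" if "n \<ge> Suc k" for n
    using that
  proof (induction n rule: dec_induct)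
    case base
    then show ?case by (simp add: k x)
  next
    case (step n)
    with hT[of n] show ?case by auto
  qed
  have "CInd \<phi> (Td h T) T"
    using td e unfolding CInd_def by blast
  moreover have "ExC \<phi> (Td h T) T"
    unfolding ExC_def
    by (rule exI[of _ "Suc k"], rule exI[of _ e]) (simp del: Td.simps add: conv e T)
  ultimately show "CInd \<phi> (Td h T) T \<and> ExC \<phi> (Td h T) T" ..
qed

lemma not_learns_singleton:
  assumes "h (Elem x) = Some NoHyp"
  shows "\<not> Txt_learns Td (\<lambda>p T. CInd \<phi> p T \<and> ExC \<phi> p T) h {x}"
proof
  assume learns: "Txt_learns Td (\<lambda>p T. CInd \<phi> p T \<and> ExC \<phi> p T) h {x}"
  have "content (\<lambda>_. Elem x) = {x}"
    unfolding content_def by auto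
  with learns have "ExC \<phi> (Td h (\<lambda>_. Elem x)) (\<lambda>_. Elem x)"
    unfolding Txt_learns_def by blast
  moreover have "Td h (\<lambda>_. Elem x) n = Some NoHyp" for n
    using assms by (induction n) auto
  ultimately show False
    unfolding ExC_def by auto
qed

text \<open>A text showing \<open>y\<close> once and \<open>x\<close> forever after forces the limit
  to be \<open>e\<close>, whatever \<open>h\<close> does on \<open>y\<close>.\<close>

lemma learns_pair_imp_C_set:
  assumes "h (Elem x) = Some (Hyp e)"
    and "Txt_learns Td (\<lambda>p T. CInd \<phi> p T \<and> ExC \<phi> p T) h {x, y}"
  shows "C_set \<phi> e = {x, y}"
proof -
  define T where "T = (\<lambda>n :: nat. if n = 0 then Elem y else Elem x)"
  have T: "content T = {x, y}"
    unfolding content_def T_def by (auto split: if_splits)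
  with assms(2) have "ExC \<phi> (Td h T) T"
    unfolding Txt_learns_def by blast
  then obtain n e' where n: "\<forall>m\<ge>n. Td h T m = Td h T n" "Td h T n = Some (Hyp e')"
      "C_set \<phi> e' = {x, y}"
    unfolding ExC_def T by blast
  \<comment> \<open>This hypothesis depends on \<open>T (Suc n)\<close>, which is
    \<open>Elem x\<close> even for \<open>n = 0\<close>.\<close>
  have "Td h T (Suc (Suc n)) = Some (Hyp e)"
    using assms(1) by (simp add: T_def)
  with n show ?thesis
    by (metis hypothesis.inject le_SucI option.inject order_refl)
qed

section \<open>The separating class\<close>

text \<open>\<open>x - x mod 3\<close> is the least element of the block of three containing
  \<open>x\<close>. One formula covers singletons and pairs, so an index is computable uniformly
  from \<open>x\<close>.\<close>

definition block_set :: "nat \<Rightarrow> nat set" where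
  "block_set x = {x, x - x mod 3}"

text \<open>\<open>Suc (3 * i)\<close> is the code of \<open>Elem (3 * i)\<close>; the value 0 codes
  \<open>?\<close>, and \<open>Suc v\<close> codes \<open>Hyp v\<close>. If \<open>\<phi> i\<close>
  diverges there, block \<open>i\<close> contributes no language.\<close>

definition separating_class :: "(nat \<Rightarrow> nat \<rightharpoonup> nat) \<Rightarrow> nat set set" where
  "separating_class \<phi> =
     {block_set (3 * i) | i. \<phi> i (Suc (3 * i)) = Some 0} \<union>
     {block_set (3 * i + k) | i k v. k \<in> {1, 2} \<and> \<phi> i (Suc (3 * i)) = Some (Suc v)}"

lemma block_set_simps [simp]:
  "block_set (3 * i) = {3 * i}"
  "block_set (Suc (3 * i)) = {3 * i, Suc (3 * i)}"
  "block_set (Suc (Suc (3 * i))) = {3 * i, Suc (Suc (3 * i))}"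
  unfolding block_set_def by (auto simp: mod_Suc)

section \<open>Uniform indices and recursiveness of the languages\<close>

lemma acceptable_block_indices:
  assumes "acceptable_numbering \<phi>"
  obtains s where "total_computable s" "\<And>x. C_index \<phi> (s x)" "\<And>x. C_set \<phi> (s x) = block_set x"
proof -
  \<comment> \<open>Membership in \<open>block_set x\<close> as nested equality tests, to be
    translated into \<open>\<phi>\<close> by acceptability.\<close>
  let ?\<psi> = "\<lambda>x z. Some (if z = x then 1 else if z = x - x mod 3 then 1 else 0)"
  have "computable 2 (\<lambda>xs. ?\<psi> (xs ! 0) (xs ! 1))"
    by (intro computable_total_if_eq computable_total_diff computable_total_mod3
        computable_total_nth computable_total_const) auto
  then have "partial_computable2 ?\<psi>"
    unfolding computable_2_iff[symmetric] .
  with assms obtain s where s: "total_computable s" "\<And>x z. \<phi> (s x) z = ?\<psi> x z"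
    unfolding acceptable_numbering_def by blast
  show thesis
    by (rule that[of s]) (auto simp: s C_index_def C_set_def block_set_def)
qed

lemma C_set_in_REC:
  assumes "acceptable_numbering \<phi>" "C_index \<phi> e"
  shows "C_set \<phi> e \<in> REC"
proof -
  have "\<phi> e = (\<lambda>x. Some (if x \<in> C_set \<phi> e then 1 else 0))"
    using assms(2) unfolding C_index_def C_set_def by force
  moreover have "partial_computable (\<phi> e)"
    using assms(1) unfolding acceptable_numbering_def by blast
  ultimately show ?thesis
    unfolding REC_def total_computable_def by simp
qed

section \<open>The partial learner\<close>

lemma partial_learnerI:
  assumes "partial_computable f"
  obtains h where "h \<in> partial_learners"
    "\<And>s. f (symbol_code s) = Some 0 \<Longrightarrow> h s = Some NoHyp"
    "\<And>s e. f (symbol_code s) = Some (Suc e) \<Longrightarrow> h s = Some (Hyp e)"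
proof -
  \<comment> \<open>The inverse of \<open>hypothesis_code\<close>, which turns a function on codes
    into a learner.\<close>
  define dec where "dec = case_nat NoHyp Hyp"
  have dec: "hypothesis_code (dec n) = n" for n
    unfolding dec_def by (cases n) auto
  define h where "h = (\<lambda>s. map_option dec (f (symbol_code s)))"
  have "map_option hypothesis_code (h s) = f (symbol_code s)" for s
    unfolding h_def by (simp add: option.map_comp comp_def dec option.map_ident)
  with assms have "h \<in> partial_learners"
    unfolding partial_learners_def by blast
  then show thesis
    by (rule that) (auto simp: h_def dec_def)
qed

lemma separating_class_partially_learnable:
  assumes acc: "acceptable_numbering \<phi>"
  shows "separating_class \<phi> \<in> Txt_REC partial_learners Td (\<lambda>p T. CInd \<phi> p T \<and> ExC \<phi> p T)"
proof -
  obtain s where s: "total_computable s" "\<And>x. C_index \<phi> (s x)" "\<And>x. C_set \<phi> (s x) = block_set x"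
    using acceptable_block_indices[OF acc] by blast
  have const: "\<exists>j. \<phi> j = (\<lambda>x. Some k)" for k
  proof -
    have "partial_computable (\<lambda>x. Some k)"
      using computable_total_const[of 1 k] computable_1_iff[of "\<lambda>x. Some k"] by simp
    with acc have "(\<lambda>x. Some k) \<in> range \<phi>"
      unfolding acceptable_numbering_def by blast
    then show ?thesis by auto
  qed
  obtain j0 j1 where j0: "\<phi> j0 = (\<lambda>x. Some 0)" and j1: "\<phi> j1 = (\<lambda>x. Some 1)"
    using const by metis
  \<comment> \<open>The learner always simulates \<open>\<phi>\<close>; where no simulation is called for, it uses an index of a
    constant function, so that no branching around a divergent computation is needed.\<close>
  define j where "j c = (if c = 0 then j1 else if c mod 3 = 1 then c div 3 else j0)" for c
  \<comment> \<open>The simulated answer is inverted: on 0 the output is \<open>Suc\<close> of an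
    index for the block set of the coded element \<open>c - 1\<close>, otherwise \<open>?\<close>.
    The bind over \<open>Some c\<close> fits \<open>computable_bind2\<close>.\<close>
  define f where "f c = Option.bind (\<phi> (j c) c)
    (\<lambda>v. Option.bind (Some c) (\<lambda>c. Some (if v = 0 then Suc (s (c - 1)) else 0)))" for c
  have s': "computable_total 1 (\<lambda>xs. s (xs ! 0))"
    using s(1) computable_1_iff[of "\<lambda>x. Some (s x)"] unfolding total_computable_def by simp
  have \<phi>': "computable 2 (\<lambda>xs. \<phi> (xs ! 0) (xs ! 1))"
    using acc computable_2_iff unfolding acceptable_numbering_def by blast
  have j': "computable_total 1 (\<lambda>xs. j (xs ! 0))"
    unfolding j_def
    by (intro computable_total_if_eq computable_total_mod3 computable_total_div3
        computable_total_nth computable_total_const) auto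
  have s2: "computable_total 2 (\<lambda>xs. s (xs ! 1 - 1))"
    using computable_bind1[OF s' computable_total_pred[OF computable_total_nth[of 1 2]]] by simp
  have "computable 1 (\<lambda>xs. \<phi> (j (xs ! 0)) (xs ! 0))"
    using computable_bind2[OF \<phi>' j' computable_total_nth[of 0 1]] by simp
  moreover have "computable_total 2 (\<lambda>xs. if xs ! 0 = 0 then Suc (s (xs ! 1 - 1)) else 0)"
    by (intro computable_total_if_eq computable_total_Suc s2 computable_total_nth
        computable_total_const) auto
  ultimately have "computable 1 (\<lambda>xs. f (xs ! 0))"
    using computable_bind2[of "\<lambda>xs. Some (if xs ! 0 = 0 then Suc (s (xs ! 1 - 1)) else 0)" 1
        "\<lambda>xs. \<phi> (j (xs ! 0)) (xs ! 0)" "\<lambda>xs. Some (xs ! 0)"] computable_total_nth[of 0 1]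
    unfolding f_def by (simp cong: if_cong)
  then have "partial_computable f"
    by (simp only: computable_1_iff)
  then obtain h where h: "h \<in> partial_learners"
    "\<And>s. f (symbol_code s) = Some 0 \<Longrightarrow> h s = Some NoHyp"
    "\<And>s e. f (symbol_code s) = Some (Suc e) \<Longrightarrow> h s = Some (Hyp e)"
    by (rule partial_learnerI) blast
  \<comment> \<open>The pause has code 0, and the constant 1 of \<open>j1\<close> makes the output
    \<open>?\<close>.\<close>
  have pause: "h Pause = Some NoHyp"
    by (intro h(2)) (simp add: f_def j_def j1)
  have j_mult: "j (Suc (3 * i)) = i" for i
  proof -
    have "Suc (3 * i) mod 3 = 1" "Suc (3 * i) div 3 = i" by presburger+
    then show ?thesis by (simp add: j_def)
  qed
  \<comment> \<open>Elements \<open>3 * i + k\<close> have codes of residue 2 or 0; the constant 0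
    of \<open>j0\<close> makes the learner output an index there.\<close>
  have j_other: "j (Suc (3 * i + k)) = j0" if "k \<in> {1, 2}" for i k
  proof -
    have "Suc (3 * i + k) mod 3 \<noteq> 1" using that by auto
    then show ?thesis by (simp add: j_def)
  qed
  have learns: "Txt_learns Td (\<lambda>p T. CInd \<phi> p T \<and> ExC \<phi> p T) h L"
    if "L \<in> separating_class \<phi>" for L
    using that unfolding separating_class_def
  proof (elim UnE CollectE exE conjE)
    fix i
    assume L: "L = block_set (3 * i)" and v: "\<phi> i (Suc (3 * i)) = Some 0"
    have "h (Elem (3 * i)) = Some (Hyp (s (3 * i)))"
      by (intro h(3)) (simp add: f_def j_mult v)
    then show ?thesis
      using pause L s by (intro transductive_learnsI[where e = "s (3 * i)" and x = "3 * i"]) auto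
  next
    fix i k v
    assume L: "L = block_set (3 * i + k)" and k: "k \<in> {1, 2}"
      and v: "\<phi> i (Suc (3 * i)) = Some (Suc v)"
    have L': "L = {3 * i, 3 * i + k}"
      using k L by auto
    have "h (Elem (3 * i)) = Some NoHyp"
      by (intro h(2)) (simp add: f_def j_mult v)
    moreover have "h (Elem (3 * i + k)) = Some (Hyp (s (3 * i + k)))"
      using j_other[OF k] by (intro h(3)) (simp add: f_def j0)
    ultimately show ?thesis
      using pause s(2) s(3)[of "3 * i + k"] unfolding L[symmetric] L'
      by (intro transductive_learnsI[where e = "s (3 * i + k)" and x = "3 * i + k"]) auto
  qed
  have "block_set x \<in> REC" for x
    using C_set_in_REC[OF acc s(2)[of x]] s(3) by simp
  then have "separating_class \<phi> \<subseteq> REC"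
    unfolding separating_class_def by blast
  with h(1) learns show ?thesis
    unfolding Txt_REC_def by blast
qed

section \<open>Diagonalization against total learners\<close>

lemma separating_class_not_totally_learnable:
  assumes acc: "acceptable_numbering \<phi>"
  shows "separating_class \<phi> \<notin> Txt_REC total_learners Td (\<lambda>p T. CInd \<phi> p T \<and> ExC \<phi> p T)"
proof
  assume "separating_class \<phi> \<in> Txt_REC total_learners Td (\<lambda>p T. CInd \<phi> p T \<and> ExC \<phi> p T)"
  then obtain h where h: "h \<in> total_learners" and
    learns: "\<And>L. L \<in> separating_class \<phi> \<Longrightarrow>
      Txt_learns Td (\<lambda>p T. CInd \<phi> p T \<and> ExC \<phi> p T) h L"
    unfolding Txt_REC_def by blast
  from h obtain f where "partial_computable f"
    and f: "\<And>s. map_option hypothesis_code (h s) = f (symbol_code s)"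
    unfolding total_learners_def partial_learners_def by blast
  \<comment> \<open>The learner on codes has an index \<open>i\<close>, so block \<open>i\<close>
    was built against it.\<close>
  with acc obtain i where "f = \<phi> i"
    unfolding acceptable_numbering_def by blast
  with f[of "Elem (3 * i)"]
  have i: "\<phi> i (Suc (3 * i)) = map_option hypothesis_code (h (Elem (3 * i)))"
    by simp
  \<comment> \<open>Totality enters here: the answer on \<open>3 * i\<close> exists, so block
    \<open>i\<close> does contribute.\<close>
  from h obtain r where r: "h (Elem (3 * i)) = Some r"
    unfolding total_learners_def by blast
  show False
  proof (cases r)
    case NoHyp
    with i r have "block_set (3 * i) \<in> separating_class \<phi>"
      unfolding separating_class_def by auto
    from learns[OF this] not_learns_singleton[of h "3 * i"] NoHyp r show False
      by simp
  next
    case (Hyp e)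
    with i r have "block_set (3 * i + k) \<in> separating_class \<phi>" if "k \<in> {1, 2}" for k
      using that unfolding separating_class_def by auto
    from learns[OF this[of 1]] learns[OF this[of 2]]
    have "Txt_learns Td (\<lambda>p T. CInd \<phi> p T \<and> ExC \<phi> p T) h {3 * i, Suc (3 * i)}"
      "Txt_learns Td (\<lambda>p T. CInd \<phi> p T \<and> ExC \<phi> p T) h {3 * i, Suc (Suc (3 * i))}"
      by simp_all
    \<comment> \<open>The index \<open>e\<close> comes from \<open>3 * i\<close> alone, so both
      pairs would equal \<open>C_set \<phi> e\<close>.\<close>
    from this[THEN learns_pair_imp_C_set[rotated]]
    have "{3 * i, Suc (3 * i)} = {3 * i, Suc (Suc (3 * i))}"
      using Hyp r by metis
    then have "Suc (3 * i) \<in> {3 * i, Suc (Suc (3 * i))}"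
      by blast
    then show False
      by simp
  qed
qed

theorem theorem7:
  fixes \<phi> :: "nat \<Rightarrow> nat \<rightharpoonup> nat"
  assumes "acceptable_numbering \<phi>"
  shows "Txt_REC total_learners Td (\<lambda>p T. CInd \<phi> p T \<and> ExC \<phi> p T)
         \<subset> Txt_REC partial_learners Td (\<lambda>p T. CInd \<phi> p T \<and> ExC \<phi> p T)"
proof -
  have "total_learners \<subseteq> partial_learners"
    unfolding total_learners_def by blast
  then have "Txt_REC total_learners Td (\<lambda>p T. CInd \<phi> p T \<and> ExC \<phi> p T)
      \<subseteq> Txt_REC partial_learners Td (\<lambda>p T. CInd \<phi> p T \<and> ExC \<phi> p T)"
    unfolding Txt_REC_def by blast
  then show ?thesis
    using separating_class_partially_learnable[OF assms]
      separating_class_not_totally_learnable[OF assms] by blast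
qed

end
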